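(* Let $n,m\in\mathbb{N}$, let $A\in\mathbb{R}^{n\times n}$ be Hurwitz, and let $B\in\mathbb{R}^{n\times m}$ and $D\in\mathbb{R}^{m\times m}$ with $D+D^{\mathsf T}$ symmetric positive definite. For $\widehat{C}\in\mathbb{R}^{m\times n}$ let $\widehat{\Sigma}(\widehat{C})$ denote the system $\dot x(t)=Ax(t)+Bu(t)$, $y(t)=\widehat{C}x(t)+Du(t)$, and let $$\widehat{\mathcal{C}}=\big\{\widehat{C}\in\mathbb{R}^{m\times n}\;\big|\;\widehat{\Sigma}(\widehat{C})\text{ is passive}\big\}.$$ Let $\widehat{C}\in\mathbb{R}^{m\times n}$ with $\widehat{C}\neq 0$ be such that $\widehat{\Sigma}(\widehat{C})$ is passive and such that there exists only one solution $X\in\mathbb{R}^{n\times n}$ of the Kalman–Yakubovich–Popov inequality $$\begin{bmatrix}-A^{\mathsf T}X-XA & \widehat{C}^{\mathsf T}-XB\\ \widehat{C}-B^{\mathsf T}X & D+D^{\mathsf T}\end{bmatrix}\succeq 0,$$ i.e. the minimal and maximal solutions $X_{\min}$ and $X_{\max}$ of the associated algebraic Riccati equation are identical, $X_{\min}=X_{\max}$. Then $\widehat{C}$ lies on the boundary of the set $\widehat{\mathcal{C}}$ (as a subset of $\mathbb{R}^{m\times n}$).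
   Context: A real square matrix is Hurwitz if all its eigenvalues have negative real part. The notation $S\succeq 0$ means that $S$ is symmetric and positive semi-definite. A system $\dot x=Ax+Bu$, $y=\widehat{C}x+Du$ is called passive if there exists a function $\mathcal{H}\colon\mathbb{R}^n\to[0,\infty)$ such that $\mathcal{H}(x(t_2))\le\mathcal{H}(x(t_1))+\int_{t_1}^{t_2}u(t)^{\mathsf T}y(t)\,\mathrm{d}t$ for all solution trajectories $(u,x,y)$ of the system and all $t_1\le t_2$. The algebraic Riccati equation associated with the inequality is $$A^{\mathsf T}X+XA+\big(\widehat{C}^{\mathsf T}-XB\big)\big(D+D^{\mathsf T}\big)^{-1}\big(\widehat{C}-B^{\mathsf T}X\big)=0 .$$ Its minimal and maximal solutions $X_{\min}$, $X_{\max}$ are also the minimal and maximal solutions of the Kalman–Yakubovich–Popov inequality, i.e. every solution $X$ of the inequality satisfies $X_{\min}\preceq X\preceq X_{\max}$ (Loewner order); hence $X_{\min}=X_{\max}$ expresses that the inequality has exactly one solution. Solutions of the inequality are automatically symmetric positive semi-definite because $A$ is Hurwitz. *)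

theory Defs
  imports "HOL-Analysis.Analysis"
begin

text \<open>A matrix with \<open>r\<close> rows and \<open>c\<close> columns is an element of \<open>real ^ 'c ^ 'r\<close>; so
  $B \in \mathbb{R}^{n \times m}$ is \<open>B :: real ^ 'm ^ 'n\<close>.\<close>

definition eigenvalue :: "'a::field ^ 'n ^ 'n \<Rightarrow> 'a \<Rightarrow> bool" where
  "eigenvalue M l \<longleftrightarrow> (\<exists>v. v \<noteq> 0 \<and> M *v v = l *s v)"

text \<open>The eigenvalues of a real matrix are those of its complexification.\<close>

definition hurwitz :: "real ^ 'n ^ 'n \<Rightarrow> bool" where
  "hurwitz A \<longleftrightarrow> (\<forall>l. eigenvalue (map_matrix complex_of_real A) l \<longrightarrow> Re l < 0)"

definition pos_semidef :: "real ^ 'k ^ 'k \<Rightarrow> bool" where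
  "pos_semidef S \<longleftrightarrow> transpose S = S \<and> (\<forall>v. 0 \<le> v \<bullet> (S *v v))"

definition pos_def :: "real ^ 'k ^ 'k \<Rightarrow> bool" where
  "pos_def S \<longleftrightarrow> transpose S = S \<and> (\<forall>v. v \<noteq> 0 \<longrightarrow> 0 < v \<bullet> (S *v v))"

definition block_matrix ::
  "'a ^ 'n ^ 'n \<Rightarrow> 'a ^ 'm ^ 'n \<Rightarrow> 'a ^ 'n ^ 'm \<Rightarrow> 'a ^ 'm ^ 'm \<Rightarrow> 'a ^ ('n + 'm) ^ ('n + 'm)" where
  "block_matrix P Q R S = (\<chi> i j.
     case i of
       Inl k \<Rightarrow> (case j of Inl l \<Rightarrow> P $ k $ l | Inr l \<Rightarrow> Q $ k $ l)
     | Inr k \<Rightarrow> (case j of Inl l \<Rightarrow> R $ k $ l | Inr l \<Rightarrow> S $ k $ l))"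

text \<open>Trajectories \<open>(u, x, y)\<close> of $\dot x = A x + B u$, $y = C x + D u$ on the whole time axis, in
  the Caratheodory sense with inputs in $L^2_{\mathrm{loc}}$. The integral equation makes \<open>x\<close>
  continuous (an indefinite integral), hence the integrand is Lebesgue integrable on compact
  intervals and \<open>x\<close> is locally absolutely continuous with $\dot x = A x + B u$ almost everywhere.
  Square integrability of \<open>u\<close> makes the supplied energy $\int u^{\mathsf T} y$ finite.\<close>

definition trajectory ::
  "real ^ 'n ^ 'n \<Rightarrow> real ^ 'm ^ 'n \<Rightarrow> real ^ 'n ^ 'm \<Rightarrow> real ^ 'm ^ 'm \<Rightarrow>
   (real \<Rightarrow> real ^ 'm) \<Rightarrow> (real \<Rightarrow> real ^ 'n) \<Rightarrow> (real \<Rightarrow> real ^ 'm) \<Rightarrow> bool" where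
  "trajectory A B C D u x y \<longleftrightarrow>
     u \<in> borel_measurable lebesgue \<and>
     (\<forall>s t. (\<lambda>\<tau>. (norm (u \<tau>))\<^sup>2) absolutely_integrable_on {s..t}) \<and>
     (\<forall>s t. s \<le> t \<longrightarrow> ((\<lambda>\<tau>. A *v x \<tau> + B *v u \<tau>) has_integral (x t - x s)) {s..t}) \<and>
     (\<forall>t. y t = C *v x t + D *v u t)"

definition passive_system ::
  "real ^ 'n ^ 'n \<Rightarrow> real ^ 'm ^ 'n \<Rightarrow> real ^ 'n ^ 'm \<Rightarrow> real ^ 'm ^ 'm \<Rightarrow> bool" where
  "passive_system A B C D \<longleftrightarrow>
     (\<exists>H :: real ^ 'n \<Rightarrow> real.
        (\<forall>z. 0 \<le> H z) \<and>
        (\<forall>u x y t1 t2. trajectory A B C D u x y \<longrightarrow> t1 \<le> t2 \<longrightarrow>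
           H (x t2) \<le> H (x t1) + integral {t1..t2} (\<lambda>t. u t \<bullet> y t)))"

text \<open>The Kalman--Yakubovich--Popov inequality. Symmetry of \<open>X\<close> is not imposed separately; only
  the block matrix is required to be symmetric.\<close>

definition kyp_solution ::
  "real ^ 'n ^ 'n \<Rightarrow> real ^ 'm ^ 'n \<Rightarrow> real ^ 'n ^ 'm \<Rightarrow> real ^ 'm ^ 'm \<Rightarrow> real ^ 'n ^ 'n \<Rightarrow> bool" where
  "kyp_solution A B C D X \<longleftrightarrow>
     pos_semidef (block_matrix
       (- (transpose A ** X) - X ** A) (transpose C - X ** B)
       (C - transpose B ** X)          (D + transpose D))"

end

theory Submission
  imports Defs "HOL-Computational_Algebra.Fundamental_Theorem_Algebra"
begin

text \<open>If \<open>C\<close> were interior, the system with output matrix \<open>(1 + e) C\<close> would be passive for a small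
  \<open>e > 0\<close> and so have a quadratic storage function. Divided by \<open>1 + e\<close>, this solves the KYP
  inequality for \<open>C\<close> with room to spare in the input block, because the feedthrough term \<open>D\<close> has
  been divided by \<open>1 + e\<close> as well. That room absorbs a small multiple of a solution \<open>Y\<close> of the
  Lyapunov equation \<open>A\<^sup>T Y + Y A = - 1\<close>, which is strict in the state block, so the KYP solution
  is not unique.

  Quadratic storage functions are obtained from arbitrary ones by sampling: for inputs constant on
  intervals of length \<open>h\<close>, the available storage is the limit of a value iteration starting at \<open>0\<close>,
  each step of which preserves the parallelogram law, and it is bounded by the given storage
  function. The resulting matrices therefore accumulate as \<open>h\<close> tends to \<open>0\<close>, and
  differentiating the sampled dissipation inequality yields the KYP inequality in the limit.\<close>

section \<open>Quadratic functionals\<close>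

text \<open>Homogeneity and the parallelogram law replace a bilinear form because they survive
  partial suprema and pointwise limits; a matrix is recovered only at the end.\<close>

definition quadratic :: "('a::real_vector \<Rightarrow> real) \<Rightarrow> bool" where
  "quadratic V \<longleftrightarrow>
     (\<forall>c x. V (c *\<^sub>R x) = c\<^sup>2 * V x) \<and>
     (\<forall>x y. V (x + y) + V (x - y) = 2 * V x + 2 * V y)"

lemma quadraticI:
  assumes "\<And>c x. V (c *\<^sub>R x) = c\<^sup>2 * V x"
    and "\<And>x y. V (x + y) + V (x - y) = 2 * V x + 2 * V y"
  shows "quadratic V"
  using assms by (auto simp: quadratic_def)

lemma quadratic_scaleR: "quadratic V \<Longrightarrow> V (c *\<^sub>R x) = c\<^sup>2 * V x"
  by (auto simp: quadratic_def)

lemma quadratic_parallelogram: "quadratic V \<Longrightarrow> V (x + y) + V (x - y) = 2 * V x + 2 * V y"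
  by (auto simp: quadratic_def)

lemma quadratic_diff:
  assumes "quadratic V" "quadratic W"
  shows "quadratic (\<lambda>x. V x - W x)"
proof (rule quadraticI)
  show "V (c *\<^sub>R x) - W (c *\<^sub>R x) = c\<^sup>2 * (V x - W x)" for c x
    using assms by (simp add: quadratic_scaleR right_diff_distrib)
  show "V (x + y) - W (x + y) + (V (x - y) - W (x - y)) = 2 * (V x - W x) + 2 * (V y - W y)" for x y
    using quadratic_parallelogram[OF assms(1), of x y] quadratic_parallelogram[OF assms(2), of x y]
    by argo
qed

lemma quadratic_compose_linear:
  assumes "quadratic V" "linear f"
  shows "quadratic (\<lambda>x. V (f x))"
  using assms by (auto simp: quadratic_def linear_add linear_diff linear_scale)

lemma quadratic_inner_linear:
  fixes f g :: "'a::real_vector \<Rightarrow> 'b::real_inner"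
  assumes "linear f" "linear g"
  shows "quadratic (\<lambda>x. f x \<bullet> g x)"
  using assms
  by (intro quadraticI)
    (simp_all add: linear_add linear_diff linear_scale power2_eq_square algebra_simps)

lemma quadratic_pointwise_limit:
  assumes V: "\<And>k. quadratic (V k)" and lim: "\<And>x. (\<lambda>k. V k x) \<longlonglongrightarrow> W x"
  shows "quadratic W"
proof (rule quadraticI)
  fix c x
  have "(\<lambda>k. V k (c *\<^sub>R x)) \<longlonglongrightarrow> c\<^sup>2 * W x"
    unfolding quadratic_scaleR[OF V] by (intro tendsto_intros lim)
  then show "W (c *\<^sub>R x) = c\<^sup>2 * W x" using lim LIMSEQ_unique by blast
next
  fix x y
  have "(\<lambda>k. V k (x + y) + V k (x - y)) \<longlonglongrightarrow> 2 * W x + 2 * W y"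
    unfolding quadratic_parallelogram[OF V] by (intro tendsto_intros lim)
  moreover have "(\<lambda>k. V k (x + y) + V k (x - y)) \<longlonglongrightarrow> W (x + y) + W (x - y)"
    by (intro tendsto_intros lim)
  ultimately show "W (x + y) + W (x - y) = 2 * W x + 2 * W y" using LIMSEQ_unique by blast
qed

text \<open>The parallelogram law of \<open>G\<close> at \<open>(x, u)\<close> and
  \<open>(y, v)\<close>, with \<open>u\<close> and \<open>v\<close> varying independently, gives one
  inequality for the supremum; that inequality at \<open>x + y\<close> and \<open>x - y\<close>,
  combined with homogeneity, gives the converse.\<close>

lemma quadratic_partial_SUP:
  fixes G :: "'a::real_vector \<times> 'b::real_vector \<Rightarrow> real"
  assumes G: "quadratic G" and bdd: "\<And>z. bdd_above (range (\<lambda>u. G (z, u)))"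
  shows "quadratic (\<lambda>z. SUP u. G (z, u))"
proof -
  define V where "V = (\<lambda>z. SUP u. G (z, u))"
  have le: "G (z, u) \<le> V z" for z u
    unfolding V_def by (rule cSUP_upper[OF UNIV_I bdd])
  have least: "V z \<le> r" if "\<And>u. G (z, u) \<le> r" for z r
    unfolding V_def by (rule cSUP_least) (use that in auto)
  have scale_ge: "c\<^sup>2 * V z \<le> V (c *\<^sub>R z)" for c z
  proof (cases "c = 0")
    case True
    have "G (0, 0) = 0" using quadratic_scaleR[OF G, of 0 "(0, 0)"] by (simp add: zero_prod_def[symmetric])
    then show ?thesis using le[of 0 0] True by simp
  next
    case False
    have "V z \<le> V (c *\<^sub>R z) / c\<^sup>2"
    proof (rule least)
      fix u
      have "c\<^sup>2 * G (z, u) \<le> V (c *\<^sub>R z)"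
        using quadratic_scaleR[OF G, of c "(z, u)"] le[of "c *\<^sub>R z" "c *\<^sub>R u"] by simp
      then show "G (z, u) \<le> V (c *\<^sub>R z) / c\<^sup>2" using False by (simp add: field_simps)
    qed
    then show ?thesis using False by (simp add: field_simps)
  qed
  have scale: "V (c *\<^sub>R z) = c\<^sup>2 * V z" for c z
  proof (cases "c = 0")
    case True
    \<comment> \<open>The factor 0 gives \<open>0 \<le> V 0\<close> and the factor 2 gives
      \<open>4 * V 0 \<le> V 0\<close>, hence \<open>V 0 = 0\<close>.\<close>
    then show ?thesis using scale_ge[of 0 0] scale_ge[of 2 0] by simp
  next
    case False
    have "(inverse c)\<^sup>2 * V (c *\<^sub>R z) \<le> V z"
      using scale_ge[of "inverse c" "c *\<^sub>R z"] False by simp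
    then have "V (c *\<^sub>R z) \<le> c\<^sup>2 * V z" using False by (simp add: field_simps)
    then show ?thesis using scale_ge[of c z] by simp
  qed
  have ge: "2 * V x + 2 * V y \<le> V (x + y) + V (x - y)" for x y
  proof -
    have "V x \<le> (V (x + y) + V (x - y)) / 2 - V y"
    proof (rule least)
      fix u
      have "V y \<le> (V (x + y) + V (x - y)) / 2 - G (x, u)"
      proof (rule least)
        fix v
        have "2 * G (x, u) + 2 * G (y, v) = G (x + y, u + v) + G (x - y, u - v)"
          using quadratic_parallelogram[OF G, of "(x, u)" "(y, v)"] by simp
        also have "\<dots> \<le> V (x + y) + V (x - y)" by (intro add_mono le)
        finally show "G (y, v) \<le> (V (x + y) + V (x - y)) / 2 - G (x, u)" by argo
      qed
      then show "G (x, u) \<le> (V (x + y) + V (x - y)) / 2 - V y" by argo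
    qed
    then show ?thesis by argo
  qed
  have "quadratic V"
  proof (rule quadraticI[OF scale])
    fix x y
    have "2 * V (x + y) + 2 * V (x - y) \<le> V (2 *\<^sub>R x) + V (2 *\<^sub>R y)"
      using ge[of "x + y" "x - y"] by (simp add: scaleR_2)
    then show "V (x + y) + V (x - y) = 2 * V x + 2 * V y"
      using ge[of x y] by (simp add: scale)
  qed
  then show ?thesis by (simp add: V_def)
qed

text \<open>The error \<open>c \<mapsto> g c - c * g 1\<close> vanishes on the integers, so it is bounded everywhere, and
  \<open>n\<close>-fold dilation then forces it to be zero.\<close>

lemma additive_bounded_imp_linear:
  fixes g :: "real \<Rightarrow> real"
  assumes add: "\<And>c d. g (c + d) = g c + g d"
    and bdd: "\<And>c. 0 \<le> c \<Longrightarrow> c \<le> 1 \<Longrightarrow> \<bar>g c\<bar> \<le> K"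
  shows "g c = c * g 1"
proof -
  define e where "e = (\<lambda>c. g c - c * g 1)"
  have eadd: "e (c + d) = e c + e d" for c d
    by (simp add: e_def add algebra_simps)
  have e0: "e 0 = 0" using eadd[of 0 0] by simp
  have emult: "e (real n * c) = real n * e c" for n c
    by (induction n) (simp_all add: e0 eadd algebra_simps)
  have eint: "e (of_int k) = 0" for k
  proof -
    have e1: "e 1 = 0" by (simp add: e_def)
    have n: "e (real n) = 0" for n using emult[of n 1] e1 by simp
    have "e (- real n) = 0" for n using eadd[of "real n" "- real n"] n e0 by simp
    with n show ?thesis by (cases k rule: int_cases2) auto
  qed
  have ebdd: "\<bar>e c\<bar> \<le> K + \<bar>g 1\<bar>" for c
  proof -
    have "e c = e (frac c)" using eadd[of "frac c" "of_int \<lfloor>c\<rfloor>"] eint by (simp add: frac_def)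
    also have "\<bar>\<dots>\<bar> \<le> \<bar>g (frac c)\<bar> + \<bar>frac c\<bar> * \<bar>g 1\<bar>"
      unfolding e_def abs_mult[symmetric] by linarith
    also have "\<dots> \<le> K + 1 * \<bar>g 1\<bar>"
      using bdd[of "frac c"] frac_lt_1[of c] by (intro add_mono mult_right_mono) auto
    finally show ?thesis by simp
  qed
  have "e c = 0"
  proof (rule ccontr)
    assume "e c \<noteq> 0"
    then obtain n :: nat where "K + \<bar>g 1\<bar> < real n * \<bar>e c\<bar>"
      using reals_Archimedean3[of "\<bar>e c\<bar>"] by auto
    then show False using ebdd[of "real n * c"] by (simp add: emult abs_mult)
  qed
  then show ?thesis by (simp add: e_def)
qed

text \<open>Jordan-von Neumann: the parallelogram law makes the polarization \<open>b\<close>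
  additive. Nonnegativity of \<open>V\<close> at \<open>c x + y\<close> and \<open>c x - y\<close>
  bounds \<open>b\<close> for \<open>c\<close> in [0, 1], which upgrades additivity to real
  homogeneity.\<close>

lemma quadratic_nonneg_imp_matrix:
  fixes V :: "real ^ 'n \<Rightarrow> real"
  assumes V: "quadratic V" and nn: "\<And>z. 0 \<le> V z"
  obtains P where "transpose P = P" "\<And>z. V z = z \<bullet> (P *v z)"
proof -
  define b where "b = (\<lambda>x y. (V (x + y) - V (x - y)) / 4)"
  have V0: "V 0 = 0" using quadratic_scaleR[OF V, of 0 0] by simp
  have Vm: "V (- x) = V x" for x using quadratic_scaleR[OF V, of "-1" x] by simp
  have bsym: "b x y = b y x" for x y
    unfolding b_def using Vm[of "x - y"] by (simp add: add.commute)
  have bVV: "b x x = V x" for x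
    using quadratic_scaleR[OF V, of 2 x] by (simp add: b_def V0 scaleR_2)
  have expand: "V (x + y) = V x + 2 * b x y + V y" for x y
    unfolding b_def using quadratic_parallelogram[OF V, of x y] by argo
  have b0: "b 0 y = 0" for y using Vm[of y] by (simp add: b_def)
  have bmid: "b (x + x') y + b (x - x') y = 2 * b x y" for x x' y
    using quadratic_parallelogram[OF V, of "x + y" x'] quadratic_parallelogram[OF V, of "x - y" x']
    by (simp add: b_def field_simps)
  have badd: "b (p + r) y = b p y + b r y" for p r y
  proof -
    \<comment> \<open>With midpoint \<open>s\<close> and half difference \<open>t\<close>,
      \<open>bmid\<close> at \<open>s, t\<close> and at \<open>s, s\<close> shows that both sides
      equal \<open>2 * b s y\<close>.\<close>
    define s where "s = (1/2) *\<^sub>R (p + r)"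
    define t where "t = (1/2) *\<^sub>R (p - r)"
    have eq: "s + t = p" "s - t = r" "s + s = p + r"
      by (simp_all add: s_def t_def vec_eq_iff field_simps)
    show ?thesis using bmid[of s t y] bmid[of s s y] unfolding eq by (simp add: b0)
  qed
  have bscale: "b (c *\<^sub>R x) y = c * b x y" for c x y
  proof -
    have "b (c *\<^sub>R x) y = c * b (1 *\<^sub>R x) y"
    proof (rule additive_bounded_imp_linear[where K = "V x + V y"])
      show "b ((c + d) *\<^sub>R x) y = b (c *\<^sub>R x) y + b (d *\<^sub>R x) y" for c d
        by (simp add: scaleR_left_distrib badd)
      fix c :: real assume c: "0 \<le> c" "c \<le> 1"
      have "0 \<le> V (c *\<^sub>R x) + 2 * b (c *\<^sub>R x) y + V y"
        using nn[of "c *\<^sub>R x + y"] by (simp add: expand)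
      moreover have "0 \<le> V (c *\<^sub>R x) - 2 * b (c *\<^sub>R x) y + V y"
      proof -
        have "b (c *\<^sub>R x) y + b (c *\<^sub>R x) (- y) = 0"
          using badd[of y "- y" "c *\<^sub>R x"] b0 by (simp add: bsym[of "c *\<^sub>R x"])
        then show ?thesis using nn[of "c *\<^sub>R x + - y"] expand[of "c *\<^sub>R x" "- y"] by (simp add: Vm)
      qed
      moreover have "V (c *\<^sub>R x) \<le> 1 * V x"
        unfolding quadratic_scaleR[OF V] using c nn[of x] by (intro mult_right_mono) (auto simp: power_le_one)
      ultimately show "\<bar>b (c *\<^sub>R x) y\<bar> \<le> V x + V y" using nn[of x] nn[of y] by linarith
    qed
    then show ?thesis by simp
  qed
  have blin: "linear (\<lambda>x. b x y)" for y
    by (intro linearI) (auto simp: badd bscale)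
  have blin': "linear (b x)" for x
    using blin[of x] by (simp add: bsym[of _ x])
  define f :: "real^'n \<Rightarrow> real^'n" where "f = (\<lambda>x. \<chi> i. b x (axis i 1))"
  have flin: "linear f"
    by (intro linearI) (auto simp: f_def vec_eq_iff badd bscale)
  define P where "P = matrix f"
  have P: "P *v x = f x" for x using flin by (simp add: P_def matrix_works linear_matrix_vector_mul_eq)
  show ?thesis
  proof
    show "transpose P = P"
      by (simp add: P_def matrix_def transpose_def f_def vec_eq_iff bsym)
    fix z
    have "z \<bullet> f z = (\<Sum>i\<in>UNIV. z $ i * b z (axis i 1))"
      by (simp add: inner_vec_def f_def)
    also have "\<dots> = b z (\<Sum>i\<in>UNIV. z $ i *\<^sub>R axis i 1)"
      by (simp add: linear_sum[OF blin'] linear_scale[OF blin'])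
    also have "(\<Sum>i\<in>UNIV. z $ i *\<^sub>R axis i 1) = z"
      using basis_expansion[of z] by (simp add: scalar_mult_eq_scaleR)
    finally show "V z = z \<bullet> (P *v z)" by (simp add: P bVV)
  qed
qed

text \<open>The \<open>k\<close>-th iterate of \<open>T\<close> is the supremum of the energy
  extractable in \<open>k\<close> steps. All iterates lie below \<open>H\<close>, so their
  increasing limit, the available storage, is finite.\<close>

lemma discrete_quadratic_storage:
  fixes \<Phi> :: "(real ^ 'n) \<times> 'b::real_vector \<Rightarrow> real ^ 'n"
    and q :: "(real ^ 'n) \<times> 'b \<Rightarrow> real" and H :: "real ^ 'n \<Rightarrow> real"
  assumes \<Phi>: "linear \<Phi>" and q: "quadratic q" and q0: "\<And>z. q (z, 0) = 0"
    and H: "\<And>z. 0 \<le> H z" and diss: "\<And>z u. H (\<Phi> (z, u)) \<le> H z + q (z, u)"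
  obtains P where "transpose P = P"
    "\<And>z. 0 \<le> z \<bullet> (P *v z)" "\<And>z. z \<bullet> (P *v z) \<le> H z"
    "\<And>z u. \<Phi> (z, u) \<bullet> (P *v \<Phi> (z, u)) \<le> z \<bullet> (P *v z) + q (z, u)"
proof -
  define T where "T = (\<lambda>V z. SUP u. V (\<Phi> (z, u)) - q (z, u))"
  define V where "V = (\<lambda>k. (T ^^ k) (\<lambda>_. 0))"
  have VSuc: "V (Suc k) = T (V k)" for k by (simp add: V_def)
  have bdd: "bdd_above (range (\<lambda>u. W (\<Phi> (z, u)) - q (z, u)))" if "\<And>z. W z \<le> H z" for W z
  proof (rule bdd_aboveI2)
    fix u show "W (\<Phi> (z, u)) - q (z, u) \<le> H z"
      using diss[of z u] that[of "\<Phi> (z, u)"] by linarith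
  qed
  have T_upper: "W (\<Phi> (z, u)) - q (z, u) \<le> T W z" if "\<And>z. W z \<le> H z" for W z u
    unfolding T_def by (rule cSUP_upper[OF UNIV_I bdd]) (rule that)
  have T_le: "T W z \<le> H z" if "\<And>z. W z \<le> H z" for W z
    unfolding T_def
  proof (rule cSUP_least)
    fix u show "W (\<Phi> (z, u)) - q (z, u) \<le> H z"
      using diss[of z u] that[of "\<Phi> (z, u)"] by linarith
  qed simp
  have VH: "V k z \<le> H z" for k z
  proof (induction k arbitrary: z)
    case 0 show ?case by (simp add: V_def H)
  next
    case (Suc k) then show ?case unfolding VSuc by (intro T_le)
  qed
  have Vmono: "V k z \<le> V (Suc k) z" for k z
  proof (induction k arbitrary: z)
    case 0
    \<comment> \<open>The zero input costs nothing, so the first iterate is nonnegative.\<close>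
    show ?case using T_upper[of "\<lambda>_. 0" z 0] by (simp add: V_def H q0)
  next
    case (Suc k)
    have "(SUP u. V k (\<Phi> (z, u)) - q (z, u)) \<le> T (V (Suc k)) z"
    proof (rule cSUP_least)
      fix u
      show "V k (\<Phi> (z, u)) - q (z, u) \<le> T (V (Suc k)) z"
        using T_upper[of "V (Suc k)" z u] VH Suc[of "\<Phi> (z, u)"] by fastforce
    qed simp
    then show ?case by (simp add: VSuc T_def)
  qed
  have Vquad: "quadratic (V k)" for k
  proof (induction k)
    case 0 show ?case by (simp add: V_def quadratic_def)
  next
    case (Suc k)
    have "quadratic (\<lambda>p. V k (\<Phi> p) - q p)"
      by (rule quadratic_diff[OF quadratic_compose_linear[OF Suc \<Phi>] q])
    from quadratic_partial_SUP[OF this bdd] show ?case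
      unfolding VSuc T_def using VH by blast
  qed
  define W where "W = (\<lambda>z. lim (\<lambda>k. V k z))"
  have inc: "incseq (\<lambda>k. V k z)" for z by (rule incseq_SucI) (rule Vmono)
  have lim: "(\<lambda>k. V k z) \<longlonglongrightarrow> W z" for z
  proof -
    obtain L where "(\<lambda>k. V k z) \<longlonglongrightarrow> L"
      using incseq_convergent[OF inc[of z]] VH by blast
    then show ?thesis by (simp add: W_def limI)
  qed
  have W0: "0 \<le> W z" for z
    using incseq_le[OF inc[of z] lim[of z], of 0] by (simp add: V_def)
  have WH: "W z \<le> H z" for z
    using LIMSEQ_le_const2[OF lim] VH by blast
  have Wdiss: "W (\<Phi> (z, u)) \<le> W z + q (z, u)" for z u
  \<comment> \<open>Shift by one index: \<open>V k\<close> after a step is controlled by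
    \<open>V (Suc k)\<close> before it, which is at most \<open>W\<close>.\<close>
  proof (rule LIMSEQ_le_const2[OF lim])
    have "V k (\<Phi> (z, u)) \<le> W z + q (z, u)" for k
      using T_upper[of "V k" z u] VH incseq_le[OF inc[of z] lim[of z], of "Suc k"] by (simp add: VSuc)
    then show "\<exists>N. \<forall>n\<ge>N. V n (\<Phi> (z, u)) \<le> W z + q (z, u)" by blast
  qed
  have "quadratic W" by (rule quadratic_pointwise_limit[OF Vquad lim])
  then obtain P where "transpose P = P" "\<And>z. W z = z \<bullet> (P *v z)"
    using quadratic_nonneg_imp_matrix W0 by blast
  then show ?thesis using that W0 WH Wdiss by metis
qed

section \<open>Trajectories with constant input\<close>

text \<open>These are the derivatives at time 0 of the solution of x' = A x + b with x(0) = z;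
  \<open>affine_flow\<close> is its Taylor series, taken componentwise so that results on real power
  series apply.\<close>

primrec affine_coeff :: "real ^ 'n ^ 'n \<Rightarrow> real ^ 'n \<Rightarrow> real ^ 'n \<Rightarrow> nat \<Rightarrow> real ^ 'n" where
  "affine_coeff A b z 0 = z"
| "affine_coeff A b z (Suc k) = A *v affine_coeff A b z k + (if k = 0 then b else 0)"

definition affine_flow :: "real ^ 'n ^ 'n \<Rightarrow> real ^ 'n \<Rightarrow> real ^ 'n \<Rightarrow> real \<Rightarrow> real ^ 'n" where
  "affine_flow A b z t = (\<chi> i. \<Sum>k. affine_coeff A b z k $ i / fact k * t ^ k)"

lemma summable_affine_coeff: "summable (\<lambda>k. affine_coeff A b z k $ i / fact k * t ^ k)"
proof -
  define K where "K = onorm ((*v) A) + 1"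
  define M where "M = norm z + norm b"
  have on: "0 \<le> onorm ((*v) A)" by (intro onorm_pos_le) simp
  \<comment> \<open>The extra \<open>norm b\<close> at \<open>k = 0\<close> makes the induction
    close: since \<open>K \<ge> 1\<close>, it absorbs the forcing term entering the coefficient of
    index 1.\<close>
  have *: "norm (affine_coeff A b z k) + (if k = 0 then norm b else 0) \<le> M * K ^ k" for k
  proof (induction k)
    case 0 then show ?case by (simp add: M_def)
  next
    case (Suc k)
    have "norm (affine_coeff A b z (Suc k))
      \<le> norm (A *v affine_coeff A b z k) + (if k = 0 then norm b else 0)"
      by (auto intro: norm_triangle_ineq)
    also have "\<dots> \<le> onorm ((*v) A) * norm (affine_coeff A b z k) + (if k = 0 then norm b else 0)"
      by (intro add_right_mono onorm) simp
    also have "\<dots> \<le> K * (norm (affine_coeff A b z k) + (if k = 0 then norm b else 0))"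
      using on by (simp add: K_def algebra_simps)
    also have "\<dots> \<le> K * (M * K ^ k)"
      using on by (intro mult_left_mono Suc) (simp add: K_def)
    finally show ?case by (simp add: ac_simps)
  qed
  have "summable (\<lambda>k. M * (inverse (fact k) * (K * \<bar>t\<bar>) ^ k))"
    by (intro summable_mult summable_exp)
  then show ?thesis
  proof (rule summable_comparison_test'[where N = 0])
    fix k
    have "\<bar>affine_coeff A b z k $ i\<bar> \<le> M * K ^ k"
      using component_le_norm_cart[of "affine_coeff A b z k" i] *[of k] by (smt (verit) norm_ge_zero)
    then have "\<bar>affine_coeff A b z k $ i\<bar> * (inverse (fact k) * \<bar>t\<bar> ^ k)
        \<le> M * K ^ k * (inverse (fact k) * \<bar>t\<bar> ^ k)"
      by (intro mult_right_mono) auto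
    then show "norm (affine_coeff A b z k $ i / fact k * t ^ k) \<le> M * (inverse (fact k) * (K * \<bar>t\<bar>) ^ k)"
      by (simp add: abs_mult power_abs divide_inverse power_mult_distrib mult_ac)
  qed
qed

lemma affine_flow_0 [simp]: "affine_flow A b z 0 = z"
  using powser_zero[of "\<lambda>k. affine_coeff A b z k $ i / fact k" for i]
  by (simp add: affine_flow_def vec_eq_iff)

lemma affine_flow_has_vector_derivative:
  fixes A :: "real ^ 'n ^ 'n"
  shows "(affine_flow A b z has_vector_derivative A *v affine_flow A b z t + b) (at t within S)"
proof -
  let ?c = "affine_coeff A b z"
  have comp: "((\<lambda>t. affine_flow A b z t $ i) has_real_derivative (A *v affine_flow A b z t + b) $ i) (at t)"
    for i
  proof -
    have "((\<lambda>t. \<Sum>k. ?c k $ i / fact k * t ^ k) has_real_derivative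
        (\<Sum>k. diffs (\<lambda>k. ?c k $ i / fact k) k * t ^ k)) (at t)"
      by (rule termdiffs_strong_converges_everywhere) (rule summable_affine_coeff)
    moreover have "(\<Sum>k. diffs (\<lambda>k. ?c k $ i / fact k) k * t ^ k) = (A *v affine_flow A b z t + b) $ i"
    proof -
      \<comment> \<open>Differentiation shifts the coefficients by one index, and the recursion
        turns the shift into multiplication by \<open>A\<close>, plus \<open>b\<close> in the
        constant term.\<close>
      have "diffs (\<lambda>k. ?c k $ i / fact k) k * t ^ k
          = (\<Sum>j\<in>UNIV. A $ i $ j * (?c k $ j / fact k * t ^ k)) + (if k = 0 then b $ i else 0)" for k
        by (simp add: diffs_def matrix_vector_mult_def sum_distrib_right sum_divide_distrib
            del: of_nat_Suc mult_Suc) (simp add: field_simps)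
      then have "(\<lambda>k. diffs (\<lambda>k. ?c k $ i / fact k) k * t ^ k) sums
          ((\<Sum>j\<in>UNIV. A $ i $ j * (\<Sum>k. ?c k $ j / fact k * t ^ k)) + b $ i)"
        using sums_add[OF sums_sum[OF sums_mult[OF summable_sums[OF summable_affine_coeff]]]
            sums_single[of 0 "\<lambda>_. b $ i"]]
        by (simp only: eq_commute[of _ "0::nat"])
      then show ?thesis by (simp add: sums_iff matrix_vector_mult_def affine_flow_def)
    qed
    ultimately show ?thesis by (simp add: affine_flow_def)
  qed
  have "((\<lambda>s. affine_flow A b z s) has_derivative (\<lambda>h. h *\<^sub>R (A *v affine_flow A b z t + b))) (at t)"
  proof (rule has_derivative_componentwise_within[THEN iffD2], rule ballI)
    fix e :: "real ^ 'n" assume "e \<in> Basis"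
    then obtain i where e: "e = axis i 1" by (auto simp: Basis_vec_def)
    show "((\<lambda>s. affine_flow A b z s \<bullet> e) has_derivative (\<lambda>h. (h *\<^sub>R (A *v affine_flow A b z t + b)) \<bullet> e)) (at t)"
      using comp[of i] by (simp add: has_field_derivative_def e inner_axis mult_commute_abs)
  qed
  then show ?thesis unfolding has_vector_derivative_def by (rule has_derivative_at_withinI)
qed

lemma continuous_on_affine_flow: "continuous_on S (affine_flow A b z)"
  by (rule continuous_on_vector_derivative) (rule affine_flow_has_vector_derivative)

lemma linear_affine_coeff:
  assumes "linear f" "linear g"
  shows "linear (\<lambda>p. affine_coeff A (f p) (g p) k)"
proof (induction k)
  case 0 show ?case using assms by simp
next
  case (Suc k)
  have "linear (\<lambda>p. if k = 0 then f p else 0)"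
    using assms(1) by (cases "k = 0") (simp_all add: linear_zero)
  with linear_compose[OF Suc matrix_vector_mul_linear] show ?case
    unfolding affine_coeff.simps o_def by (rule linear_compose_add)
qed

text \<open>Joint linearity in initial state and forcing term; it is applied to
  \<open>p = (z, u)\<close> with forcing term \<open>B *v u\<close>.\<close>

lemma linear_affine_flow:
  assumes "linear f" "linear g"
  shows "linear (\<lambda>p. affine_flow A (f p) (g p) t)"
proof (rule linearI)
  note lin = linear_affine_coeff[OF assms]
  show "affine_flow A (f (p + r)) (g (p + r)) t = affine_flow A (f p) (g p) t + affine_flow A (f r) (g r) t" for p r
    by (simp add: affine_flow_def vec_eq_iff linear_add[OF lin] add_divide_distrib distrib_right
        suminf_add[OF summable_affine_coeff[unfolded times_divide_eq_left]
          summable_affine_coeff[unfolded times_divide_eq_left]])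
  have "(\<Sum>k. (c *\<^sub>R a k) / fact k * t ^ k) = c * (\<Sum>k. a k / fact k * t ^ k)"
    if "summable (\<lambda>k. a k / fact k * t ^ k)" for c and a :: "nat \<Rightarrow> real"
    using suminf_mult[OF that, of c] by (simp add: mult.assoc)
  then show "affine_flow A (f (c *\<^sub>R p)) (g (c *\<^sub>R p)) t = c *\<^sub>R affine_flow A (f p) (g p) t" for c p
    using summable_affine_coeff[of A "f p" "g p" _ t]
    by (simp add: affine_flow_def vec_eq_iff linear_scale[OF lin])
qed

text \<open>Passivity is exploited only along these trajectories.\<close>

lemma trajectory_constant_input:
  "trajectory A B C D (\<lambda>_. u) (affine_flow A (B *v u) z) (\<lambda>t. C *v affine_flow A (B *v u) z t + D *v u)"
  unfolding trajectory_def
proof (intro conjI allI impI)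
  show "(\<lambda>\<tau>. (norm u)\<^sup>2) absolutely_integrable_on {s..t}" for s t :: real
    by (intro absolutely_integrable_continuous_real continuous_intros)
  show "((\<lambda>\<tau>. A *v affine_flow A (B *v u) z \<tau> + B *v u) has_integral
      affine_flow A (B *v u) z t - affine_flow A (B *v u) z s) {s..t}" if "s \<le> t" for s t
    by (rule fundamental_theorem_of_calculus[OF that]) (rule affine_flow_has_vector_derivative)
qed auto

section \<open>Limits and bounds for matrices\<close>

lemma tendsto_matrix_vector_mult:
  fixes P :: "'a \<Rightarrow> real ^ 'n ^ 'm"
  assumes "(P \<longlongrightarrow> P') F" "(w \<longlongrightarrow> w') F"
  shows "((\<lambda>k. P k *v w k) \<longlongrightarrow> P' *v w') F"
  unfolding matrix_vector_mult_def by (intro tendsto_intros assms)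

lemma inner_transpose_mult: "x \<bullet> (transpose M *v y) = (M *v x) \<bullet> y"
  for M :: "real ^ 'n ^ 'm"
  by (metis dot_lmul_matrix vector_transpose_matrix transpose_transpose)

text \<open>Diagonal entries are bounded by \<open>H\<close> at the unit vectors, and
  semidefiniteness at sums and differences of two unit vectors bounds the other entries by the
  diagonal ones.\<close>

lemma bounded_range_psd_matrices:
  fixes P :: "nat \<Rightarrow> real ^ 'n ^ 'n"
  assumes sym: "\<And>j. transpose (P j) = P j" and psd: "\<And>j z. 0 \<le> z \<bullet> (P j *v z)"
    and bound: "\<And>j z. z \<bullet> (P j *v z) \<le> H z"
  shows "bounded (range P)"
proof -
  have entry: "\<bar>P j $ i $ k\<bar> \<le> H (axis i 1) + H (axis k 1)" for i j k
  proof -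
    have ent: "axis i 1 \<bullet> (P j *v axis k 1) = P j $ i $ k" for i k
      by (simp add: matrix_vector_mul_component[symmetric] inner_axis' matrix_vector_mult_basis column_def)
    have symm: "P j $ k $ i = P j $ i $ k"
      using sym[of j] by (metis transpose_def vec_lambda_beta)
    have "0 \<le> P j $ i $ i + 2 * P j $ i $ k + P j $ k $ k"
      using psd[of "axis i 1 + axis k 1" j]
      by (simp add: matrix_vector_right_distrib inner_add_left inner_add_right ent symm)
    moreover have "0 \<le> P j $ i $ i - 2 * P j $ i $ k + P j $ k $ k"
      using psd[of "axis i 1 - axis k 1" j]
      by (simp add: matrix_vector_mult_diff_distrib inner_diff_left inner_diff_right ent symm)
    ultimately show ?thesis
      using bound[of "axis i 1" j] bound[of "axis k 1" j] psd[of "axis i 1" j] psd[of "axis k 1" j]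
      unfolding ent by linarith
  qed
  have "norm (P j) \<le> (\<Sum>i\<in>UNIV. \<Sum>k\<in>UNIV. H (axis i 1) + H (axis k 1))" for j
  proof -
    have "norm (P j) \<le> (\<Sum>i\<in>UNIV. norm (P j $ i))"
      unfolding norm_vec_def by (rule L2_set_le_sum) simp
    also have "\<dots> \<le> (\<Sum>i\<in>UNIV. \<Sum>k\<in>UNIV. \<bar>P j $ i $ k\<bar>)"
      by (intro sum_mono norm_le_l1_cart)
    also have "\<dots> \<le> (\<Sum>i\<in>UNIV. \<Sum>k\<in>UNIV. H (axis i 1) + H (axis k 1))"
      by (intro sum_mono entry)
    finally show ?thesis .
  qed
  then show ?thesis by (auto simp: bounded_iff)
qed

section \<open>Quadratic storage for passive systems\<close>

text \<open>\<open>H\<close> may be irregular, so it is never differentiated: it only bounds the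
  sampled storage matrices uniformly in the step length. The factor 2 is that of the derivative of
  \<open>z \<bullet> (P *v z)\<close>.\<close>

lemma passive_imp_dissipation_matrix:
  fixes A :: "real ^ 'n ^ 'n" and B :: "real ^ 'm ^ 'n"
  assumes "passive_system A B C D"
  obtains P where "transpose P = P"
    "\<And>z u. 2 * ((A *v z + B *v u) \<bullet> (P *v z)) \<le> u \<bullet> (C *v z + D *v u)"
proof -
  obtain H :: "real ^ 'n \<Rightarrow> real" where H0: "\<And>z. 0 \<le> H z"
    and H: "\<And>u x y t1 t2. trajectory A B C D u x y \<Longrightarrow> t1 \<le> t2 \<Longrightarrow>
           H (x t2) \<le> H (x t1) + integral {t1..t2} (\<lambda>t. u t \<bullet> y t)"
    using assms unfolding passive_system_def by blast
  define x where "x = (\<lambda>(z, u). affine_flow A (B *v u) z)"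
  define q where "q = (\<lambda>h (z, u). integral {0..h} (\<lambda>t. u \<bullet> (C *v x (z, u) t + D *v u)))"
  define hs where "hs = (\<lambda>j. inverse (real (Suc j)))"
  have hs_pos: "0 < hs j" for j by (simp add: hs_def)
  have x_lin: "linear (\<lambda>p. x p t)" for t
    unfolding x_def case_prod_beta
    by (intro linear_affine_flow linear_compose[OF linear_snd, unfolded o_def] linear_fst) simp
  have x_cont: "continuous_on S (x p)" for S p
    unfolding x_def case_prod_beta by (rule continuous_on_affine_flow)
  have x_deriv: "(x (z, u) has_vector_derivative A *v x (z, u) t + B *v u) (at t within S)" for z u t S
    unfolding x_def by (simp add: affine_flow_has_vector_derivative)
  have x_int: "x p integrable_on {0..h}" for p h
    by (intro integrable_continuous_real x_cont)
  have supply_cont: "continuous_on S (\<lambda>t. u \<bullet> (C *v x (z, u) t + D *v u))" for S z u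
    by (intro continuous_intros linear_continuous_on_compose[OF x_cont]) simp
  \<comment> \<open>Moving the integral inside exhibits the supplied energy as an inner product of
    two linear maps, hence as quadratic.\<close>
  have q_eq: "q h p = snd p \<bullet> (C *v integral {0..h} (x p) + h *\<^sub>R (D *v snd p))" if "0 \<le> h" for h p
  proof -
    obtain z u where p: "p = (z, u)" by force
    have 1: "((\<lambda>t. C *v x p t) has_integral C *v integral {0..h} (x p)) {0..h}"
      using has_integral_linear[OF integrable_integral[OF x_int] matrix_vector_mul_bounded_linear]
      by (simp add: o_def)
    have 2: "((\<lambda>t. D *v u) has_integral h *\<^sub>R (D *v u)) {0..h}"
      using has_integral_const_real[of "D *v u" 0 h] that by simp
    have "((\<lambda>t. u \<bullet> (C *v x p t + D *v u)) has_integral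
        u \<bullet> (C *v integral {0..h} (x p) + h *\<^sub>R (D *v u))) {0..h}"
      using has_integral_linear[OF has_integral_add[OF 1 2] bounded_linear_inner_right[of u]]
      by (simp add: o_def)
    then show ?thesis unfolding q_def p by (auto simp: integral_unique)
  qed
  have int_lin: "linear (\<lambda>p. integral {0..h} (x p))" for h
  proof (rule linearI)
    show "integral {0..h} (x (p + r)) = integral {0..h} (x p) + integral {0..h} (x r)" for p r
      using integral_add[OF x_int[of p h] x_int[of r h]] linear_add[OF x_lin, of p r]
      by (simp cong: integral_cong)
    show "integral {0..h} (x (c *\<^sub>R p)) = c *\<^sub>R integral {0..h} (x p)" for c p
      using integral_cmul[of "{0..h}" c "x p"] linear_scale[OF x_lin, of c p]
      by (simp cong: integral_cong)
  qed
  have q_quad: "quadratic (q (hs j))" for j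
  proof -
    have "linear (\<lambda>p. C *v integral {0..hs j} (x p) + hs j *\<^sub>R (D *v snd p))"
      by (rule linearI) (simp_all add: linear_add[OF int_lin] linear_scale[OF int_lin]
          matrix_vector_right_distrib matrix_vector_mult_scaleR algebra_simps)
    moreover have "q (hs j) = (\<lambda>p. snd p \<bullet> (C *v integral {0..hs j} (x p) + hs j *\<^sub>R (D *v snd p)))"
      using hs_pos[of j] by (intro ext q_eq) simp
    ultimately show ?thesis by (simp add: quadratic_inner_linear[OF linear_snd])
  qed
  have "\<exists>P. transpose P = P \<and> (\<forall>z. 0 \<le> z \<bullet> (P *v z)) \<and> (\<forall>z. z \<bullet> (P *v z) \<le> H z) \<and>
    (\<forall>z u. x (z, u) (hs j) \<bullet> (P *v x (z, u) (hs j)) \<le> z \<bullet> (P *v z) + q (hs j) (z, u))" for j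
  proof -
    have diss: "H (x (z, u) (hs j)) \<le> H z + q (hs j) (z, u)" for z u
      using H[OF trajectory_constant_input[of A B C D u z], of 0 "hs j"] hs_pos[of j]
      by (simp add: x_def q_def)
    have q0: "q (hs j) (z, 0) = 0" for z by (simp add: q_def)
    show ?thesis
      by (rule discrete_quadratic_storage[OF x_lin q_quad q0 H0 diss]) blast
  qed
  then obtain P where sym: "\<And>j. transpose (P j) = P j" and psd: "\<And>j z. 0 \<le> z \<bullet> (P j *v z)"
    and PH: "\<And>j z. z \<bullet> (P j *v z) \<le> H z"
    and diss: "\<And>j z u. x (z, u) (hs j) \<bullet> (P j *v x (z, u) (hs j)) \<le> z \<bullet> (P j *v z) + q (hs j) (z, u)"
    by metis
  obtain r P' where r: "strict_mono (r :: nat \<Rightarrow> nat)" and P': "(\<lambda>j. P (r j)) \<longlonglongrightarrow> P'"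
    using bounded_imp_convergent_subsequence[OF bounded_range_psd_matrices[of P, OF sym psd PH]]
    unfolding o_def by blast
  have hs_lim: "(\<lambda>j. hs (r j)) \<longlonglongrightarrow> 0"
    using LIMSEQ_subseq_LIMSEQ[OF LIMSEQ_inverse_real_of_nat r] by (simp add: hs_def o_def)
  \<comment> \<open>The limit is one-sided because the supply integral is differentiated at its left
    endpoint; \<open>hs j \<le> 1\<close> keeps the samples in the interval.\<close>
  have hs_filter: "filterlim (\<lambda>j. hs (r j)) (at 0 within {0..1}) sequentially"
    unfolding filterlim_at using hs_lim hs_pos
    by (auto simp: hs_def inverse_le_1_iff less_imp_le less_imp_neq[symmetric] simp del: of_nat_Suc)
  have P'sym: "transpose P' = P'"
  proof -
    have "P' $ k $ i = P' $ i $ k" for i k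
    proof -
      have "P j $ k $ i = P j $ i $ k" for j
        using sym[of j] by (metis transpose_def vec_lambda_beta)
      then have "(\<lambda>j. P (r j) $ k $ i) \<longlonglongrightarrow> P' $ i $ k" using P' by (auto intro: tendsto_intros)
      moreover have "(\<lambda>j. P (r j) $ k $ i) \<longlonglongrightarrow> P' $ k $ i" using P' by (auto intro: tendsto_intros)
      ultimately show ?thesis by (rule LIMSEQ_unique[symmetric])
    qed
    then show ?thesis by (simp add: transpose_def vec_eq_iff)
  qed
  have "2 * ((A *v z + B *v u) \<bullet> (P' *v z)) \<le> u \<bullet> (C *v z + D *v u)" for z u
  proof -
    define X where "X = x (z, u)"
    have X0: "X 0 = z" by (simp add: X_def x_def)
    define d where "d = A *v z + B *v u"
    have "((\<lambda>h. (X h - X 0 - (h - 0) *\<^sub>R d) /\<^sub>R norm (h - 0)) \<longlongrightarrow> 0) (at 0 within {0..1})"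
      using x_deriv[of z u 0 "{0..1}"]
      unfolding has_vector_derivative_def has_derivative_at_within X_def[symmetric] X0 d_def by blast
    from filterlim_compose[OF this hs_filter]
    have "(\<lambda>j. (X (hs (r j)) - z - hs (r j) *\<^sub>R d) /\<^sub>R norm (hs (r j))) \<longlonglongrightarrow> 0"
      by (simp add: X0)
    moreover have "(X (hs j) - z - hs j *\<^sub>R d) /\<^sub>R norm (hs j) = (X (hs j) - z) /\<^sub>R hs j - d" for j
      using hs_pos[of j] by (simp add: scaleR_diff_right)
    ultimately have w: "(\<lambda>j. (X (hs (r j)) - z) /\<^sub>R hs (r j)) \<longlonglongrightarrow> A *v z + B *v u"
      unfolding d_def[symmetric] by (simp add: LIM_zero_cancel)
    have s: "(\<lambda>j. X (hs (r j)) + z) \<longlonglongrightarrow> z + z"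
    proof -
      have "isCont X 0" using x_cont[of UNIV "(z, u)"] by (simp add: X_def continuous_on_eq_continuous_at)
      then have "(\<lambda>j. X (hs (r j))) \<longlonglongrightarrow> X 0" using hs_lim by (rule isCont_tendsto_compose)
      then show ?thesis by (intro tendsto_intros) (simp add: X0)
    qed
    have "((\<lambda>h. q h (z, u)) has_real_derivative u \<bullet> (C *v X 0 + D *v u)) (at 0 within {0..1})"
      unfolding q_def prod.case X_def
      by (rule integral_has_real_derivative[OF supply_cont]) simp
    then have "((\<lambda>h. (q h (z, u) - q 0 (z, u)) / (h - 0)) \<longlongrightarrow> u \<bullet> (C *v z + D *v u)) (at 0 within {0..1})"
      unfolding has_field_derivative_iff X0 .
    from filterlim_compose[OF this hs_filter]
    have qlim: "(\<lambda>j. q (hs (r j)) (z, u) / hs (r j)) \<longlonglongrightarrow> u \<bullet> (C *v z + D *v u)"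
      by (simp add: q_def)
    \<comment> \<open>By symmetry the difference of the two quadratic values factors as
      \<open>(X - z) \<bullet> (P (X + z))\<close>. Hence only the difference quotient of
      \<open>X\<close> is needed, although \<open>P j\<close> varies with \<open>j\<close>.\<close>
    have le: "((X (hs j) - z) /\<^sub>R hs j) \<bullet> (P j *v (X (hs j) + z)) \<le> q (hs j) (z, u) / hs j" for j
    proof -
      have "X (hs j) \<bullet> (P j *v z) = z \<bullet> (P j *v X (hs j))"
        using inner_transpose_mult[of "X (hs j)" "P j" z] by (simp add: sym inner_commute)
      then have "(X (hs j) - z) \<bullet> (P j *v (X (hs j) + z)) \<le> q (hs j) (z, u)"
        using diss[of z u j]
        by (simp add: X_def[symmetric] matrix_vector_right_distrib inner_diff_left inner_add_right)
      from mult_left_mono[OF this, of "inverse (hs j)"] show ?thesis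
        using hs_pos[of j] by (simp add: divide_inverse mult.commute)
    qed
    have "(A *v z + B *v u) \<bullet> (P' *v (z + z)) \<le> u \<bullet> (C *v z + D *v u)"
      by (rule LIMSEQ_le[OF tendsto_inner[OF w tendsto_matrix_vector_mult[OF P' s]] qlim]) (use le in blast)
    then show ?thesis unfolding matrix_vector_right_distrib inner_add_right by argo
  qed
  with P'sym show ?thesis by (rule that)
qed

section \<open>The Lyapunov equation\<close>

text \<open>Stated for a family, since iterates of an operator may repeat: a repetition is itself a
  relation, and otherwise the indices up to \<open>DIM('a)\<close> give one vector more than the
  dimension.\<close>

lemma family_linearly_dependent:
  fixes g :: "nat \<Rightarrow> 'a::euclidean_space"
  obtains N c k where "k \<le> N" "c k \<noteq> 0" "(\<Sum>i\<le>N. c i *\<^sub>R g i) = 0"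
proof (cases "inj_on g {..DIM('a)}")
  case True
  then have "dependent (g ` {..DIM('a)})"
    by (intro dependent_biggerset) (simp_all add: card_image)
  then obtain u where u: "\<exists>v\<in>g ` {..DIM('a)}. u v \<noteq> 0" "(\<Sum>v\<in>g ` {..DIM('a)}. u v *\<^sub>R v) = 0"
    using dependent_finite[of "g ` {..DIM('a)}"] by auto
  obtain k where "k \<le> DIM('a)" "u (g k) \<noteq> 0" using u(1) by auto
  then show ?thesis
    using u(2) by (intro that[of k "DIM('a)" "u \<circ> g"]) (simp_all add: sum.reindex[OF True])
next
  case False
  then obtain i j where ij: "i \<noteq> j" "g i = g j" by (auto simp: inj_on_def)
  let ?c = "\<lambda>k. (if k = i then 1 else 0) - (if k = j then 1 else 0 :: real)"
  have "(\<Sum>k\<le>max i j. ?c k *\<^sub>R g k) = (\<Sum>k\<le>max i j. if k = i then g k else 0) - (\<Sum>k\<le>max i j. if k = j then g k else 0)"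
    unfolding sum_subtractf[symmetric] by (intro sum.cong) auto
  also have "\<dots> = 0" using ij by simp
  finally show ?thesis using ij by (intro that[of i "max i j" ?c]) auto
qed

text \<open>Some nonzero polynomial in \<open>f\<close> annihilates \<open>w\<close>; splitting off its roots one at a time, the last
  nonzero image of \<open>w\<close> is an eigenvector. The scalar multiplication is a parameter so that the
  lemma applies to operators on a space of matrices.\<close>

lemma eigenvector_in_invariant_subspace:
  fixes sc :: "complex \<Rightarrow> 'a::euclidean_space \<Rightarrow> 'a"
  assumes hom: "module_hom sc sc f" and real: "\<And>r x. sc (complex_of_real r) x = r *\<^sub>R x"
    and S: "module.subspace sc S" "f ` S \<subseteq> S" and w: "w \<in> S" "w \<noteq> 0"
  obtains v l where "v \<in> S" "v \<noteq> 0" "f v = sc l v"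
proof -
  interpret module_hom sc sc f by (rule hom)
  \<comment> \<open>\<open>E p w\<close> is the value of the polynomial \<open>p\<close> at the
    operator \<open>f\<close>, applied to \<open>w\<close>.\<close>
  define E where "E = (\<lambda>p w. \<Sum>i\<le>degree p. sc (coeff p i) ((f ^^ i) w))"
  have E_ext: "E p w = (\<Sum>i\<le>N. sc (coeff p i) ((f ^^ i) w))" if "degree p \<le> N" for p N w
    unfolding E_def by (rule sum.mono_neutral_left) (use that in \<open>auto simp: coeff_eq_0\<close>)
  have pow_diff: "(f ^^ i) (x - sc l y) = (f ^^ i) x - sc l ((f ^^ i) y)" for i x y l
    by (induction i) (simp_all add: diff scale)
  have E_factor: "E ([:- l, 1:] * q) w = E q (f w - sc l w)" for l q w
  proof -
    define N where "N = degree q"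
    have "degree ([:- l, 1:] * q) \<le> Suc N"
      by (rule order.trans[OF degree_mult_le]) (simp add: N_def)
    then have "E ([:- l, 1:] * q) w = (\<Sum>i\<le>Suc N. sc (coeff (pCons 0 q) i - l * coeff q i) ((f ^^ i) w))"
      by (subst E_ext) (auto simp: mult_pCons_left algebra_simps)
    also have "\<dots> = (\<Sum>i\<le>Suc N. sc (coeff (pCons 0 q) i) ((f ^^ i) w)) - (\<Sum>i\<le>Suc N. sc l (sc (coeff q i) ((f ^^ i) w)))"
      by (simp only: m1.scale_left_diff_distrib sum_subtractf m1.scale_scale)
    also have "(\<Sum>i\<le>Suc N. sc (coeff (pCons 0 q) i) ((f ^^ i) w)) = (\<Sum>i\<le>N. sc (coeff q i) ((f ^^ i) (f w)))"
      by (subst sum.atMost_Suc_shift) (simp add: funpow_swap1)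
    also have "(\<Sum>i\<le>Suc N. sc l (sc (coeff q i) ((f ^^ i) w))) = (\<Sum>i\<le>N. sc l (sc (coeff q i) ((f ^^ i) w)))"
      by (simp add: N_def coeff_eq_0)
    also have "(\<Sum>i\<le>N. sc (coeff q i) ((f ^^ i) (f w))) - \<dots> = E q (f w - sc l w)"
      by (simp add: E_def N_def pow_diff m1.scale_right_diff_distrib sum_subtractf mult.commute)
    finally show ?thesis .
  qed
  have step: "\<exists>v l. v \<in> S \<and> v \<noteq> 0 \<and> f v = sc l v"
    if "p \<noteq> 0" "w \<in> S" "w \<noteq> 0" "E p w = 0" for p w
    using that
  proof (induction "degree p" arbitrary: p w)
    case 0
    then obtain a where a: "p = [:a:]" by (metis degree_eq_zeroE)
    with 0 have "sc a w = 0" "a \<noteq> 0" by (simp_all add: E_def)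
    then have "sc (inverse a * a) w = 0" by (metis m1.scale_scale m1.scale_zero_right)
    with \<open>a \<noteq> 0\<close> \<open>w \<noteq> 0\<close> show ?case by simp
  next
    case (Suc n)
    have "\<not> constant (poly p)" using Suc(2) by (simp add: constant_degree)
    then obtain l where "poly p l = 0" using fundamental_theorem_of_algebra by blast
    then obtain q where q: "p = [:- l, 1:] * q" by (metis poly_eq_0_iff_dvd dvdE)
    have "q \<noteq> 0" using q Suc(3) by auto
    have "n = degree q" using Suc(2) degree_mult_eq[of "[:- l, 1:]" q] \<open>q \<noteq> 0\<close> unfolding q by simp
    \<comment> \<open>Either \<open>w\<close> is an eigenvector for the root \<open>l\<close>, or
      \<open>f w - sc l w\<close> is a nonzero vector of \<open>S\<close> annihilated by the
      quotient \<open>q\<close>.\<close>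
    show ?case
    proof (cases "f w = sc l w")
      case True then show ?thesis using Suc.prems by blast
    next
      case False
      have "f w - sc l w \<in> S"
        using S Suc.prems(2) by (intro m1.subspace_diff m1.subspace_scale) auto
      then show ?thesis
        using Suc.hyps(1)[OF \<open>n = degree q\<close> \<open>q \<noteq> 0\<close>] False Suc.prems(4) unfolding q E_factor by auto
    qed
  qed
  \<comment> \<open>Dimension is counted over the reals, so the relation between the iterates has
    real coefficients.\<close>
  obtain N c k where k: "k \<le> N" "c k \<noteq> (0 :: real)" and c: "(\<Sum>i\<le>N. c i *\<^sub>R (f ^^ i) w) = 0"
    by (rule family_linearly_dependent)
  define p where "p = (\<Sum>i\<le>N. monom (complex_of_real (c i)) i)"
  have coeff_p: "coeff p i = (if i \<le> N then complex_of_real (c i) else 0)" for i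
    by (simp add: p_def coeff_sum coeff_monom)
  have "p \<noteq> 0" using coeff_p[of k] k by auto
  moreover have "E p w = 0"
    using c by (subst E_ext[of p N]) (auto simp: coeff_p real intro!: degree_le)
  ultimately show ?thesis using step w that by blast
qed

text \<open>If \<open>M - mat l\<close> is injective, it has a left inverse, which for a square
  matrix is also a right inverse; transposed, it shows that \<open>transpose M - mat l\<close> is
  injective too.\<close>

lemma eigenvalue_transpose:
  fixes M :: "'a::field ^ 'n ^ 'n"
  assumes "eigenvalue (transpose M) l"
  shows "eigenvalue M l"
proof (rule ccontr)
  assume "\<not> eigenvalue M l"
  let ?N = "M - mat l"
  have mat_l: "mat l *v x = l *s x" for x :: "'a ^ 'n"
    by (simp add: vec_eq_iff matrix_vector_mult_def mat_def mult_delta_left)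
  have "inj ((*v) ?N)"
  proof (rule injI)
    fix x y assume "?N *v x = ?N *v y"
    then have "M *v (x - y) = l *s (x - y)"
      by (simp add: matrix_vector_mult_diff_rdistrib matrix_vector_mult_diff_distrib mat_l algebra_simps
          vector_ssub_ldistrib)
    then show "x = y" using \<open>\<not> eigenvalue M l\<close> unfolding eigenvalue_def by (metis right_minus_eq)
  qed
  then obtain K where "K ** ?N = mat 1" by (auto simp: matrix_left_invertible_injective[symmetric])
  then have "?N ** K = mat 1" by (simp add: matrix_left_right_inverse)
  then have K: "transpose K ** transpose ?N = mat 1" by (metis matrix_transpose_mul transpose_mat)
  obtain v where v: "v \<noteq> 0" "transpose M *v v = l *s v" using assms by (auto simp: eigenvalue_def)
  have "transpose ?N = transpose M - mat l"
    by (simp add: transpose_def mat_def vec_eq_iff)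
  then have "transpose ?N *v v = 0" using v by (simp add: matrix_vector_mult_diff_rdistrib mat_l)
  then have "v = 0" using K by (metis matrix_vector_mul_assoc matrix_vector_mul_lid matrix_vector_mult_0_right)
  then show False using v by simp
qed

text \<open>On the kernel of \<open>Y \<mapsto> A\<^sup>T Y + Y A\<close>, right multiplication by \<open>A\<close> has an eigenvector \<open>Y\<close>
  for some \<open>l\<close>; the rows of \<open>Y\<close> then show that \<open>l\<close>, its columns that \<open>- l\<close>, is an eigenvalue of \<open>A\<close>.\<close>

lemma hurwitz_lyapunov_injective:
  fixes A Y :: "real ^ 'n ^ 'n"
  assumes "hurwitz A" and Y: "transpose A ** Y + Y ** A = 0"
  shows "Y = 0"
proof (rule ccontr)
  assume "Y \<noteq> 0"
  define cx :: "real ^ 'n ^ 'n \<Rightarrow> complex ^ 'n ^ 'n" where "cx = map_matrix complex_of_real"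
  \<comment> \<open>Matrices carry only real scaling as a vector space, so complex scaling is
    introduced by hand.\<close>
  define sc :: "complex \<Rightarrow> complex ^ 'n ^ 'n \<Rightarrow> complex ^ 'n ^ 'n" where "sc = (\<lambda>c M. \<chi> i. c *s M $ i)"
  define S where "S = {Z. transpose (cx A) ** Z + Z ** cx A = 0}"
  have cx_mult: "cx (M ** N) = cx M ** cx N" for M N
    by (simp add: cx_def vec_eq_iff matrix_matrix_mult_def)
  have cx_transpose: "cx (transpose M) = transpose (cx M)" for M
    by (simp add: cx_def vec_eq_iff transpose_def)
  have module: "module sc"
    by unfold_locales (simp_all add: sc_def vec_eq_iff algebra_simps)
  have hom: "module_hom sc sc (\<lambda>Z. Z ** cx A)"
    using module
    by (auto simp: module_hom_def module_hom_axioms_def sc_def vec_eq_iff matrix_matrix_mult_def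
        sum_distrib_left sum.distrib algebra_simps)
  have add_mult: "(Z + W) ** M = Z ** M + W ** M" for Z W M :: "complex ^ 'n ^ 'n"
    by (simp add: vec_eq_iff matrix_matrix_mult_def sum.distrib distrib_right)
  have right_scale: "sc c Z ** M = sc c (Z ** M)" for c Z M
    by (simp add: sc_def vec_eq_iff matrix_matrix_mult_def sum_distrib_left algebra_simps)
  have left_scale: "M ** sc c Z = sc c (M ** Z)" for c Z M
    by (simp add: sc_def vec_eq_iff matrix_matrix_mult_def sum_distrib_left algebra_simps)
  have "cx Y \<in> S"
  proof -
    have "cx (transpose A ** Y + Y ** A) = 0" using Y by (simp add: cx_def vec_eq_iff)
    moreover have "cx (M + N) = cx M + cx N" for M N by (simp add: cx_def vec_eq_iff)
    ultimately show ?thesis by (simp add: S_def cx_mult cx_transpose)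
  qed
  moreover have "cx Y \<noteq> 0" using \<open>Y \<noteq> 0\<close> by (auto simp: cx_def vec_eq_iff)
  moreover have "module.subspace sc S"
    unfolding module.subspace_def[OF module]
  proof (intro conjI ballI allI)
    show "0 \<in> S" by (simp add: S_def matrix_matrix_mult_def vec_eq_iff)
    show "x + y \<in> S" if "x \<in> S" "y \<in> S" for x y
    proof -
      have "transpose (cx A) ** (x + y) + (x + y) ** cx A
        = (transpose (cx A) ** x + x ** cx A) + (transpose (cx A) ** y + y ** cx A)"
        by (simp add: matrix_add_ldistrib add_mult)
      then show ?thesis using that by (simp add: S_def)
    qed
    show "sc c x \<in> S" if "x \<in> S" for c x
    proof -
      have "transpose (cx A) ** sc c x + sc c x ** cx A = sc c (transpose (cx A) ** x + x ** cx A)"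
        by (simp add: left_scale right_scale) (simp add: sc_def vec_eq_iff algebra_simps)
      also have "\<dots> = sc c 0" using that by (simp add: S_def)
      also have "\<dots> = 0" by (simp add: sc_def vec_eq_iff)
      finally show ?thesis by (simp add: S_def)
    qed
  qed
  moreover have "(\<lambda>Z. Z ** cx A) ` S \<subseteq> S"
  proof safe
    fix Z assume "Z \<in> S"
    have "transpose (cx A) ** (Z ** cx A) + (Z ** cx A) ** cx A = (transpose (cx A) ** Z + Z ** cx A) ** cx A"
      by (simp add: add_mult matrix_mul_assoc)
    also have "\<dots> = 0" using \<open>Z \<in> S\<close> by (simp add: S_def matrix_matrix_mult_def vec_eq_iff)
    finally show "Z ** cx A \<in> S" by (simp add: S_def)
  qed
  moreover have "sc (complex_of_real r) Z = r *\<^sub>R Z" for r Z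
    unfolding sc_def vec_eq_iff by (simp add: scaleR_conv_of_real[where 'a = complex])
  ultimately obtain Z l where Z: "Z \<in> S" "Z \<noteq> 0" "Z ** cx A = sc l Z"
    using eigenvector_in_invariant_subspace[OF hom] by metis
  have "transpose (cx A) ** Z = - (Z ** cx A)"
    using Z(1) by (simp add: S_def eq_neg_iff_add_eq_0)
  also have "\<dots> = sc (- l) Z" unfolding Z(3) by (simp add: sc_def vec_eq_iff)
  finally have left: "transpose (cx A) ** Z = sc (- l) Z" .
  obtain i j where ij: "Z $ i $ j \<noteq> 0" using Z(2) by (auto simp: vec_eq_iff)
  have "transpose (cx A) *v (Z $ i) = l *s Z $ i"
    using Z(3) by (simp add: vec_eq_iff matrix_matrix_mult_def matrix_vector_mult_def transpose_def sc_def mult.commute)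
  moreover have "Z $ i \<noteq> 0" using ij by auto
  ultimately have "eigenvalue (transpose (cx A)) l" by (auto simp: eigenvalue_def)
  moreover have "transpose (cx A) *v column j Z = (- l) *s column j Z"
    using left by (simp add: vec_eq_iff matrix_matrix_mult_def matrix_vector_mult_def column_def sc_def)
  moreover have "column j Z \<noteq> 0" using ij by (auto simp: column_def vec_eq_iff)
  ultimately have "eigenvalue (transpose (cx A)) l" "eigenvalue (transpose (cx A)) (- l)"
    by (auto simp: eigenvalue_def)
  then have "eigenvalue (cx A) l" "eigenvalue (cx A) (- l)" by - (rule eigenvalue_transpose, assumption)+
  then have "Re l < 0" "Re (- l) < 0" using assms(1) unfolding hurwitz_def cx_def by blast+
  then show False by simp
qed

text \<open>An injective linear map of a finite-dimensional space to itself is surjective. The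
  transpose of a solution solves the same equation, so uniqueness gives symmetry.\<close>

lemma hurwitz_lyapunov_solution:
  fixes A :: "real ^ 'n ^ 'n"
  assumes A: "hurwitz A"
  obtains Y where "transpose Y = Y" "transpose A ** Y + Y ** A = - mat 1"
proof -
  define L where "L = (\<lambda>Y. transpose A ** Y + Y ** A)"
  have "linear L"
    by (rule linearI) (simp_all add: L_def vec_eq_iff matrix_matrix_mult_def sum.distrib sum_distrib_left algebra_simps)
  moreover have "inj L"
    unfolding linear_injective_0[OF \<open>linear L\<close>] unfolding L_def
    using hurwitz_lyapunov_injective[OF A] by blast
  ultimately have "surj L" by (rule linear_inj_imp_surj)
  then obtain Y where Y: "L Y = - mat 1" by (metis surjD)
  have "L (transpose Y) = transpose (L Y)"
    by (simp add: L_def transpose_def vec_eq_iff matrix_matrix_mult_def algebra_simps)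
  then have "L (transpose Y - Y) = transpose (L Y) - L Y"
    by (simp add: linear_diff[OF \<open>linear L\<close>])
  also have "\<dots> = 0" by (simp add: Y transpose_def mat_def vec_eq_iff)
  finally have "transpose Y - Y = 0" unfolding L_def by (rule hurwitz_lyapunov_injective[OF A])
  then show ?thesis using Y unfolding L_def by (intro that[of Y]) simp_all
qed

section \<open>Non-uniqueness of KYP solutions\<close>

lemma sum_UNIV_Plus:
  "(\<Sum>i\<in>UNIV. f i) = (\<Sum>i\<in>UNIV. f (Inl i)) + (\<Sum>i\<in>UNIV. f (Inr i))"
  for f :: "'a::finite + 'b::finite \<Rightarrow> 'c::comm_monoid_add"
  using sum.Plus[of "UNIV :: 'a set" "UNIV :: 'b set" f] by (simp add: o_def)

lemma transpose_block_matrix: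
  "transpose (block_matrix P Q R S) = block_matrix (transpose P) (transpose R) (transpose Q) (transpose S)"
  by (simp add: vec_eq_iff transpose_def block_matrix_def split: sum.split)

lemma inner_block_matrix_mult:
  fixes P :: "real ^ 'n ^ 'n" and S :: "real ^ 'm ^ 'm" and v :: "real ^ ('n + 'm)"
  defines "z \<equiv> \<chi> i. v $ Inl i" and "u \<equiv> \<chi> i. v $ Inr i"
  shows "v \<bullet> (block_matrix P Q R S *v v) =
    z \<bullet> (P *v z) + z \<bullet> (Q *v u) + u \<bullet> (R *v z) + u \<bullet> (S *v u)"
proof -
  have "(block_matrix P Q R S *v v) $ Inl i = (P *v z + Q *v u) $ i" for i
    by (simp add: matrix_vector_mult_def block_matrix_def sum_UNIV_Plus z_def u_def)
  moreover have "(block_matrix P Q R S *v v) $ Inr i = (R *v z + S *v u) $ i" for i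
    by (simp add: matrix_vector_mult_def block_matrix_def sum_UNIV_Plus z_def u_def)
  ultimately have "v \<bullet> (block_matrix P Q R S *v v) = z \<bullet> (P *v z + Q *v u) + u \<bullet> (R *v z + S *v u)"
    unfolding inner_vec_def sum_UNIV_Plus by (simp add: z_def u_def)
  then show ?thesis by (simp add: inner_add_right)
qed

text \<open>The block form at \<open>(z, u)\<close> is twice the gap in the dissipation inequality
  for the storage function \<open>z \<bullet> (X *v z) / 2\<close>.\<close>

lemma kyp_solution_if_dissipative:
  fixes A :: "real ^ 'n ^ 'n" and B :: "real ^ 'm ^ 'n"
  assumes X: "transpose X = X"
    and diss: "\<And>z u. (A *v z + B *v u) \<bullet> (X *v z) \<le> u \<bullet> (C *v z + D *v u)"
  shows "kyp_solution A B C D X"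
  unfolding kyp_solution_def pos_semidef_def
proof (intro conjI allI)
  have minus: "transpose (M - N) = transpose M - transpose N" for M N :: "real ^ 'a ^ 'b"
    by (simp add: transpose_def vec_eq_iff)
  have uminus: "transpose (- M) = - transpose M" for M :: "real ^ 'a ^ 'b"
    by (simp add: transpose_def vec_eq_iff)
  have plus: "transpose (M + N) = transpose M + transpose N" for M N :: "real ^ 'a ^ 'b"
    by (simp add: transpose_def vec_eq_iff)
  show "transpose (block_matrix (- (transpose A ** X) - X ** A) (transpose C - X ** B)
         (C - transpose B ** X) (D + transpose D))
      = block_matrix (- (transpose A ** X) - X ** A) (transpose C - X ** B)
         (C - transpose B ** X) (D + transpose D)"
    by (simp add: transpose_block_matrix minus uminus plus matrix_transpose_mul X add.commute minus_diff_commute)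
next
  fix v :: "real ^ ('n + 'm)"
  define z :: "real ^ 'n" where "z = (\<chi> i. v $ Inl i)"
  define u :: "real ^ 'm" where "u = (\<chi> i. v $ Inr i)"
  have uminus: "(- M) *v x = - (M *v x)" for M :: "real ^ 'n ^ 'n" and x
    by (simp add: vec_eq_iff matrix_vector_mult_def sum_negf)
  have XA: "z \<bullet> (X *v w) = w \<bullet> (X *v z)" for w
    using inner_transpose_mult[of z X w] by (simp add: X inner_commute)
  have "z \<bullet> ((- (transpose A ** X) - X ** A) *v z) = - 2 * ((A *v z) \<bullet> (X *v z))"
    using XA[of "A *v z"] inner_transpose_mult[of z A "X *v z"]
    by (simp add: matrix_vector_mult_diff_rdistrib uminus inner_diff_right flip: matrix_vector_mul_assoc)
  moreover have "z \<bullet> ((transpose C - X ** B) *v u) = u \<bullet> (C *v z) - (B *v u) \<bullet> (X *v z)"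
    using XA[of "B *v u"] inner_transpose_mult[of z C u]
    by (simp add: matrix_vector_mult_diff_rdistrib inner_diff_right inner_commute flip: matrix_vector_mul_assoc)
  moreover have "u \<bullet> ((C - transpose B ** X) *v z) = u \<bullet> (C *v z) - (B *v u) \<bullet> (X *v z)"
    using inner_transpose_mult[of u B "X *v z"]
    by (simp add: matrix_vector_mult_diff_rdistrib inner_diff_right flip: matrix_vector_mul_assoc)
  moreover have "u \<bullet> ((D + transpose D) *v u) = 2 * (u \<bullet> (D *v u))"
    using inner_transpose_mult[of u D u] by (simp add: matrix_vector_mult_add_rdistrib inner_add_right inner_commute)
  ultimately have "v \<bullet> (block_matrix (- (transpose A ** X) - X ** A) (transpose C - X ** B)
         (C - transpose B ** X) (D + transpose D) *v v)
      = 2 * (u \<bullet> (C *v z + D *v u) - (A *v z + B *v u) \<bullet> (X *v z))"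
    unfolding inner_block_matrix_mult z_def[symmetric] u_def[symmetric] inner_add_left inner_add_right
    by argo
  then show "0 \<le> v \<bullet> (block_matrix (- (transpose A ** X) - X ** A) (transpose C - X ** B)
         (C - transpose B ** X) (D + transpose D) *v v)"
    using diss[of z u] by simp
qed

text \<open>The constant is the minimum of the form on the compact unit sphere; homogeneity does the
  rest.\<close>

lemma pos_def_coercive:
  fixes R :: "real ^ 'm ^ 'm"
  assumes "pos_def R"
  obtains c where "c > 0" "\<And>u. c * (norm u)\<^sup>2 \<le> u \<bullet> (R *v u)"
proof -
  have "continuous_on (sphere 0 1) (\<lambda>u. u \<bullet> (R *v u))"
    by (intro continuous_intros linear_continuous_on) simp
  moreover have "sphere (0 :: real ^ 'm) 1 \<noteq> {}" by simp
  ultimately obtain w where "w \<in> sphere 0 1" "\<forall>u\<in>sphere 0 1. w \<bullet> (R *v w) \<le> u \<bullet> (R *v u)"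
    using continuous_attains_inf[OF compact_sphere] by blast
  then have w: "norm w = 1" "norm u = 1 \<Longrightarrow> w \<bullet> (R *v w) \<le> u \<bullet> (R *v u)" for u
    by simp_all
  show ?thesis
  proof
    have "w \<noteq> 0" using w(1) by force
    then show "0 < w \<bullet> (R *v w)" using assms unfolding pos_def_def by blast
    fix u :: "real ^ 'm"
    show "w \<bullet> (R *v w) * (norm u)\<^sup>2 \<le> u \<bullet> (R *v u)"
    proof (cases "u = 0")
      case False
      then have "w \<bullet> (R *v w) \<le> (u /\<^sub>R norm u) \<bullet> (R *v (u /\<^sub>R norm u))" by (intro w(2)) simp
      also have "\<dots> = u \<bullet> (R *v u) / (norm u)\<^sup>2"
        by (simp add: matrix_vector_mult_scaleR power2_eq_square divide_inverse)
      finally show ?thesis using False by (simp add: field_simps)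
    qed simp
  qed
qed

text \<open>Dividing a storage matrix for \<open>(1 + e) C\<close> by \<open>1 + e\<close> gives one for \<open>C\<close> in which the
  feedthrough term is only needed up to the factor \<open>1 / (1 + e)\<close>. The remaining
  share of \<open>u \<bullet> (D *v u)\<close> pays for adding a small multiple of a Lyapunov matrix \<open>Y\<close>.\<close>

lemma passive_scaled_imp_two_kyp_solutions:
  fixes A :: "real ^ 'n ^ 'n" and B :: "real ^ 'm ^ 'n"
  assumes A: "hurwitz A" and D: "pos_def (D + transpose D)"
    and e: "e > 0" and pas: "passive_system A B ((1 + e) *\<^sub>R C) D"
  obtains X X' where "kyp_solution A B C D X" "kyp_solution A B C D X'" "X \<noteq> X'"
proof -
  obtain P where P: "transpose P = P"
    and diss: "\<And>z u. 2 * ((A *v z + B *v u) \<bullet> (P *v z)) \<le> u \<bullet> (((1 + e) *\<^sub>R C) *v z + D *v u)"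
    by (rule passive_imp_dissipation_matrix[OF pas]) blast
  obtain Y where Y: "transpose Y = Y" "transpose A ** Y + Y ** A = - mat 1"
    by (rule hurwitz_lyapunov_solution[OF A])
  obtain c where c: "c > 0" "\<And>u. c * (norm u)\<^sup>2 \<le> u \<bullet> ((D + transpose D) *v u)"
    by (rule pos_def_coercive[OF D]) blast
  \<comment> \<open>The 2 passes from the storage \<open>z \<bullet> (P *v z)\<close> to the halved
    normalization. \<open>k = 1 - 1 / (1 + e)\<close> is the spare share of \<open>D\<close>, and
    \<open>h\<close> is chosen to make \<open>h * K\<^sup>2 \<le> k * c\<close>, with
    \<open>+ 1\<close> keeping its denominator positive.\<close>
  define X where "X = (2 / (1 + e)) *\<^sub>R P"
  define k where "k = e / (1 + e)"
  define K where "K = onorm (\<lambda>u. Y *v (B *v u))"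
  define h where "h = k * c / (K\<^sup>2 + 1)"
  have "k > 0" using e by (simp add: k_def)
  have "h > 0" using \<open>k > 0\<close> c(1) by (simp add: h_def add_nonneg_pos)
  have D_sym: "u \<bullet> ((D + transpose D) *v u) = 2 * (u \<bullet> (D *v u))" for u
    using inner_transpose_mult[of u D u] by (simp add: matrix_vector_mult_add_rdistrib inner_add_right inner_commute)
  have D_nonneg: "0 \<le> u \<bullet> (D *v u)" for u
    using c(2)[of u] c(1) D_sym[of u] by (smt (verit) mult_nonneg_nonneg zero_le_power2)
  have X_diss: "(A *v z + B *v u) \<bullet> (X *v z) \<le> u \<bullet> (C *v z + D *v u) - k * (u \<bullet> (D *v u))" for z u
  proof -
    have "(A *v z + B *v u) \<bullet> (X *v z) = 2 * ((A *v z + B *v u) \<bullet> (P *v z)) / (1 + e)"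
      by (simp add: X_def scaleR_matrix_vector_assoc[symmetric])
    also have "\<dots> \<le> u \<bullet> (((1 + e) *\<^sub>R C) *v z + D *v u) / (1 + e)"
      using diss e by (intro divide_right_mono) auto
    also have "\<dots> = u \<bullet> (C *v z + D *v u) - k * (u \<bullet> (D *v u))"
      using e unfolding scaleR_matrix_vector_assoc[symmetric] inner_add_right inner_scaleR_right k_def
      by (simp add: field_simps)
    finally show ?thesis .
  qed
  have Y_diss: "h * ((A *v z + B *v u) \<bullet> (Y *v z)) \<le> k * (u \<bullet> (D *v u))" for z u
  proof -
    have "z \<bullet> ((transpose A ** Y + Y ** A) *v z) = 2 * ((A *v z) \<bullet> (Y *v z))"
      using inner_transpose_mult[of z Y "A *v z"] inner_transpose_mult[of z A "Y *v z"]
      by (simp add: Y(1) matrix_vector_mult_add_rdistrib inner_add_right inner_commute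
          flip: matrix_vector_mul_assoc)
    moreover have "(- mat 1) *v z = - z"
      using matrix_vector_mult_diff_rdistrib[of 0 "mat 1" z] by simp
    ultimately have AY: "(A *v z) \<bullet> (Y *v z) = - (norm z)\<^sup>2 / 2"
      by (simp add: Y(2) power2_norm_eq_inner)
    have "(B *v u) \<bullet> (Y *v z) = z \<bullet> (Y *v (B *v u))"
      using inner_transpose_mult[of "B *v u" Y z] by (simp add: Y(1) inner_commute)
    \<comment> \<open>Young's inequality, weighted so that the \<open>z\<close> term cancels exactly
      against the one from the Lyapunov equation.\<close>
    also have "\<dots> \<le> (norm z)\<^sup>2 / 2 + (norm (Y *v (B *v u)))\<^sup>2 / 2"
      using zero_le_power2[of "norm (z - Y *v (B *v u))"]
      by (simp add: power2_norm_eq_inner inner_diff_left inner_diff_right inner_commute field_simps)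
    also have "(norm (Y *v (B *v u)))\<^sup>2 \<le> (K * norm u)\<^sup>2"
      unfolding K_def
      by (intro power_mono onorm bounded_linear_compose[OF matrix_vector_mul_bounded_linear]) auto
    finally have "(A *v z + B *v u) \<bullet> (Y *v z) \<le> (K * norm u)\<^sup>2 / 2"
      by (simp add: inner_add_left AY)
    then have "h * ((A *v z + B *v u) \<bullet> (Y *v z)) \<le> h * ((K * norm u)\<^sup>2 / 2)"
      using \<open>h > 0\<close> by simp
    also have "\<dots> \<le> h * (K\<^sup>2 + 1) * (norm u)\<^sup>2 / 2"
      using \<open>h > 0\<close> by (simp add: power_mult_distrib algebra_simps)
    also have "h * (K\<^sup>2 + 1) = k * c"
      unfolding h_def using zero_le_power2[of K] by (simp add: add_nonneg_eq_0_iff)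
    also have "k * c * (norm u)\<^sup>2 / 2 \<le> k * (u \<bullet> (D *v u))"
      using mult_left_mono[OF c(2)[of u], of k] \<open>k > 0\<close> by (simp add: D_sym)
    finally show ?thesis .
  qed
  have X_sym: "transpose X = X" using P by (simp add: X_def transpose_def vec_eq_iff)
  show ?thesis
  proof
    show "kyp_solution A B C D X"
    proof (rule kyp_solution_if_dissipative[OF X_sym])
      show "(A *v z + B *v u) \<bullet> (X *v z) \<le> u \<bullet> (C *v z + D *v u)" for z u
        using X_diss[of z u] D_nonneg[of u] \<open>k > 0\<close> by (smt (verit) mult_nonneg_nonneg)
    qed
    show "kyp_solution A B C D (X + h *\<^sub>R Y)"
    proof (rule kyp_solution_if_dissipative)
      show "transpose (X + h *\<^sub>R Y) = X + h *\<^sub>R Y"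
        using X_sym Y(1) by (simp add: transpose_def vec_eq_iff)
      show "(A *v z + B *v u) \<bullet> ((X + h *\<^sub>R Y) *v z) \<le> u \<bullet> (C *v z + D *v u)" for z u
        using X_diss[of z u] Y_diss[of z u]
        by (simp add: matrix_vector_mult_add_rdistrib scaleR_matrix_vector_assoc[symmetric] inner_add_right)
    qed
    have "mat 1 $ i $ i \<noteq> (0 :: real ^ 'n ^ 'n) $ i $ i" for i :: 'n by (simp add: mat_def)
    then have "Y \<noteq> 0" using Y(2) by fastforce
    then show "X \<noteq> X + h *\<^sub>R Y" using \<open>h > 0\<close> by simp
  qed
qed

section \<open>The boundary of the set of passive output matrices\<close>

theorem theorem3p10:
  fixes A :: "real ^ 'n ^ 'n"
    and B :: "real ^ 'm ^ 'n"
    and C :: "real ^ 'n ^ 'm"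
    and D :: "real ^ 'm ^ 'm"
  assumes "hurwitz A"
    and "pos_def (D + transpose D)"
    and "C \<noteq> 0"
    and "passive_system A B C D"
    and "\<exists>!X. kyp_solution A B C D X"
  shows "C \<in> frontier {C'. passive_system A B C' D}"
proof -
  have "C \<notin> interior {C'. passive_system A B C' D}"
  proof
    assume "C \<in> interior {C'. passive_system A B C' D}"
    then obtain r where r: "r > 0" "ball C r \<subseteq> {C'. passive_system A B C' D}"
      by (auto simp: mem_interior)
    \<comment> \<open>The \<open>+ 1\<close> makes the displacement \<open>e * norm C\<close>
      strictly smaller than \<open>r\<close>.\<close>
    define e where "e = r / (norm C + 1)"
    have "e > 0" using r(1) by (simp add: e_def add_nonneg_pos)
    have "norm C + 1 \<noteq> 0" using norm_ge_zero[of C] by linarith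
    then have "e * (norm C + 1) = r" by (simp add: e_def)
    then have "e * norm C < r" using \<open>e > 0\<close> by (simp add: distrib_left)
    then have "(1 + e) *\<^sub>R C \<in> ball C r"
      using \<open>e > 0\<close> by (simp add: dist_norm scaleR_left_distrib)
    then have "passive_system A B ((1 + e) *\<^sub>R C) D" using r(2) by blast
    from passive_scaled_imp_two_kyp_solutions[OF assms(1,2) \<open>e > 0\<close> this]
    show False using assms(5) by metis
  qed
  then show ?thesis
    using assms(4) closure_subset[of "{C'. passive_system A B C' D}"] by (auto simp: frontier_def)
qed

end
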